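(* Let $M$ be an isometrically immersed submanifold of a metallic Riemannian manifold $(\bar M,J,g)$ with $J^2=pJ+qI$, and let $\nabla$ be the Levi-Civita connection of the induced metric on $M$. If $M$ is slant with slant angle $\theta$, then $$(\nabla_XT^2)Y=p\cos^2(\theta)\,(\nabla_XT)Y$$ for any $X,Y\in\Gamma(TM)$.
   Context: A metallic Riemannian manifold $(\bar M,J,g)$ is a smooth manifold with a $(1,1)$-tensor field $J$ satisfying $J^2=pJ+qI$ for some positive integers $p,q$ and a Riemannian metric $g$ with $g(JX,Y)=g(X,JY)$ for all vector fields $X,Y$. For $X\in\Gamma(TM)$, $TX:=(JX)^T$ is the component of $JX$ tangent to $M$. $M$ is slant if for all $x\in M$ and nonzero $X_x\in T_xM$ the angle $\theta(X_x)\in[0,\pi/2]$ between $JX_x$ and $T_xM$ is a constant $\theta$ (independent of $x$ and $X_x$), called the slant angle; one has $\cos\theta(X_x)=\|TX_x\|/\|JX_x\|$. For a $(1,1)$-tensor field $S$ on $M$, $(\nabla_XS)Y:=\nabla_X(SY)-S(\nabla_XY)$. *)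

theory Defs
  imports "HOL-Analysis.Analysis"
begin

section \<open>Smooth maps between Euclidean spaces\<close>

text \<open>Only used on open sets \<open>S\<close>, so that the full derivative at a point is the right notion.\<close>

primrec Ck_on :: "nat \<Rightarrow> 'a set \<Rightarrow> ('a::euclidean_space \<Rightarrow> 'b::euclidean_space) \<Rightarrow> bool" where
  "Ck_on 0 S f \<longleftrightarrow> continuous_on S f"
| "Ck_on (Suc k) S f \<longleftrightarrow> (\<forall>x\<in>S. f differentiable (at x)) \<and>
     (\<forall>v. Ck_on k S (\<lambda>x. frechet_derivative f (at x) v))"

definition smooth_on :: "'a set \<Rightarrow> ('a::euclidean_space \<Rightarrow> 'b::euclidean_space) \<Rightarrow> bool" where
  "smooth_on S f \<longleftrightarrow> (\<forall>k. Ck_on k S f)"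

section \<open>Smooth manifolds\<close>

text \<open>A chart is a pair \<open>(U, \<phi>)\<close> with \<open>U\<close> an open subset of the manifold; the values of \<open>\<phi>\<close> outside
  \<open>U\<close> are irrelevant. The manifold is the whole topological space \<open>'m\<close>, modelled on \<open>'e\<close>.\<close>

type_synonym ('m, 'e) chart = "'m set \<times> ('m \<Rightarrow> 'e)"

definition chart_dom :: "('m, 'e) chart \<Rightarrow> 'm set" where
  "chart_dom c = fst c"

definition coord :: "('m, 'e) chart \<Rightarrow> 'm \<Rightarrow> 'e" where
  "coord c = snd c"

definition chart_ran :: "('m, 'e) chart \<Rightarrow> 'e set" where
  "chart_ran c = coord c ` chart_dom c"

definition param :: "('m, 'e) chart \<Rightarrow> 'e \<Rightarrow> 'm" where
  "param c = inv_into (chart_dom c) (coord c)"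

definition smooth_manifold ::
    "('m::{t2_space, second_countable_topology}, 'e::euclidean_space) chart set \<Rightarrow> bool" where
  "smooth_manifold A \<longleftrightarrow>
     (\<forall>c\<in>A. open (chart_dom c) \<and> open (chart_ran c) \<and> homeomorphism (chart_dom c) (chart_ran c) (coord c) (param c)) \<and>
     (\<Union>c\<in>A. chart_dom c) = UNIV \<and>
     (\<forall>c\<in>A. \<forall>c'\<in>A. smooth_on (coord c ` (chart_dom c \<inter> chart_dom c')) (coord c' \<circ> param c))"

definition smooth_map :: "('m::topological_space, 'e::euclidean_space) chart set \<Rightarrow>
    ('n::topological_space, 'f::euclidean_space) chart set \<Rightarrow> ('m \<Rightarrow> 'n) \<Rightarrow> bool" where
  "smooth_map A B f \<longleftrightarrow> continuous_on UNIV f \<and>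
     (\<forall>a\<in>A. \<forall>b\<in>B. smooth_on (coord a ` (chart_dom a \<inter> f -` chart_dom b)) (coord b \<circ> f \<circ> param a))"

definition smooth_fun :: "('m, 'e::euclidean_space) chart set \<Rightarrow> ('m \<Rightarrow> real) \<Rightarrow> bool" where
  "smooth_fun A h \<longleftrightarrow> (\<forall>c\<in>A. smooth_on (chart_ran c) (h \<circ> param c))"

section \<open>Tangent vectors and tensor fields\<close>

text \<open>For every point \<open>x\<close> we select once and for all a chart around \<open>x\<close> and identify the tangent space
  at \<open>x\<close> with the model space \<open>'e\<close> by taking components with respect to that chart. The selected
  chart may jump with \<open>x\<close>, so smoothness of a field is expressed through its components in
  the charts of the atlas, to which \<open>to_chart\<close> and \<open>from_chart\<close> translate.\<close>

definition chart_at :: "('m, 'e) chart set \<Rightarrow> 'm \<Rightarrow> ('m, 'e) chart" where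
  "chart_at A x = (SOME c. c \<in> A \<and> x \<in> chart_dom c)"

definition to_chart :: "('m, 'e::euclidean_space) chart set \<Rightarrow> ('m, 'e) chart \<Rightarrow> 'm \<Rightarrow> 'e \<Rightarrow> 'e" where
  "to_chart A c x =
     frechet_derivative (coord c \<circ> param (chart_at A x)) (at (coord (chart_at A x) x))"

definition from_chart :: "('m, 'e::euclidean_space) chart set \<Rightarrow> ('m, 'e) chart \<Rightarrow> 'm \<Rightarrow> 'e \<Rightarrow> 'e" where
  "from_chart A c x =
     frechet_derivative (coord (chart_at A x) \<circ> param c) (at (coord c x))"

definition differential :: "('m, 'e::euclidean_space) chart set \<Rightarrow>
    ('n, 'f::euclidean_space) chart set \<Rightarrow> ('m \<Rightarrow> 'n) \<Rightarrow> 'm \<Rightarrow> 'e \<Rightarrow> 'f" where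
  "differential A B f x =
     frechet_derivative (coord (chart_at B (f x)) \<circ> f \<circ> param (chart_at A x))
       (at (coord (chart_at A x) x))"

definition smooth_vector_field ::
    "('m, 'e::euclidean_space) chart set \<Rightarrow> ('m \<Rightarrow> 'e) \<Rightarrow> bool" where
  "smooth_vector_field A X \<longleftrightarrow>
     (\<forall>c\<in>A. smooth_on (chart_ran c) (\<lambda>y. to_chart A c (param c y) (X (param c y))))"

text \<open>The function \<open>X h\<close>.\<close>

definition deriv_along ::
    "('m, 'e::euclidean_space) chart set \<Rightarrow> ('m \<Rightarrow> 'e) \<Rightarrow> ('m \<Rightarrow> real) \<Rightarrow> 'm \<Rightarrow> real" where
  "deriv_along A X h x =
     frechet_derivative (h \<circ> param (chart_at A x)) (at (coord (chart_at A x) x)) (X x)"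

definition tensor11_field ::
    "('m, 'e::euclidean_space) chart set \<Rightarrow> ('m \<Rightarrow> 'e \<Rightarrow> 'e) \<Rightarrow> bool" where
  "tensor11_field A S \<longleftrightarrow> (\<forall>x. linear (S x)) \<and>
     (\<forall>c\<in>A. \<forall>u. smooth_on (chart_ran c)
        (\<lambda>y. to_chart A c (param c y) (S (param c y) (from_chart A c (param c y) u))))"

definition riemannian_metric ::
    "('m, 'e::euclidean_space) chart set \<Rightarrow> ('m \<Rightarrow> 'e \<Rightarrow> 'e \<Rightarrow> real) \<Rightarrow> bool" where
  "riemannian_metric A g \<longleftrightarrow>
     (\<forall>x. bilinear (g x) \<and> (\<forall>u v. g x u v = g x v u) \<and> (\<forall>u. u \<noteq> 0 \<longrightarrow> g x u u > 0)) \<and>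
     (\<forall>c\<in>A. \<forall>u v. smooth_on (chart_ran c)
        (\<lambda>y. g (param c y) (from_chart A c (param c y) u) (from_chart A c (param c y) v)))"

section \<open>The Levi-Civita connection\<close>

definition affine_connection :: "('m, 'e::euclidean_space) chart set \<Rightarrow>
    (('m \<Rightarrow> 'e) \<Rightarrow> ('m \<Rightarrow> 'e) \<Rightarrow> 'm \<Rightarrow> 'e) \<Rightarrow> bool" where
  "affine_connection A nabla \<longleftrightarrow>
     (\<forall>X Y. smooth_vector_field A X \<and> smooth_vector_field A Y \<longrightarrow>
        smooth_vector_field A (nabla X Y)) \<and>
     (\<forall>X X' Y. smooth_vector_field A X \<and> smooth_vector_field A X' \<and> smooth_vector_field A Y \<longrightarrow>
        nabla (\<lambda>x. X x + X' x) Y = (\<lambda>x. nabla X Y x + nabla X' Y x)) \<and>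
     (\<forall>h X Y. smooth_fun A h \<and> smooth_vector_field A X \<and> smooth_vector_field A Y \<longrightarrow>
        nabla (\<lambda>x. h x *\<^sub>R X x) Y = (\<lambda>x. h x *\<^sub>R nabla X Y x)) \<and>
     (\<forall>X Y Y'. smooth_vector_field A X \<and> smooth_vector_field A Y \<and> smooth_vector_field A Y' \<longrightarrow>
        nabla X (\<lambda>x. Y x + Y' x) = (\<lambda>x. nabla X Y x + nabla X Y' x)) \<and>
     (\<forall>h X Y. smooth_fun A h \<and> smooth_vector_field A X \<and> smooth_vector_field A Y \<longrightarrow>
        nabla X (\<lambda>x. h x *\<^sub>R Y x) = (\<lambda>x. deriv_along A X h x *\<^sub>R Y x + h x *\<^sub>R nabla X Y x))"

text \<open>\<open>nabla X Y - nabla Y X = [X, Y]\<close>, the bracket being given by \<open>[X, Y] h = X (Y h) - Y (X h)\<close>.\<close>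

definition torsion_free :: "('m, 'e::euclidean_space) chart set \<Rightarrow>
    (('m \<Rightarrow> 'e) \<Rightarrow> ('m \<Rightarrow> 'e) \<Rightarrow> 'm \<Rightarrow> 'e) \<Rightarrow> bool" where
  "torsion_free A nabla \<longleftrightarrow>
     (\<forall>X Y h. smooth_vector_field A X \<and> smooth_vector_field A Y \<and> smooth_fun A h \<longrightarrow>
        deriv_along A (\<lambda>x. nabla X Y x - nabla Y X x) h =
          (\<lambda>x. deriv_along A X (deriv_along A Y h) x - deriv_along A Y (deriv_along A X h) x))"

definition metric_compatible :: "('m, 'e::euclidean_space) chart set \<Rightarrow>
    ('m \<Rightarrow> 'e \<Rightarrow> 'e \<Rightarrow> real) \<Rightarrow> (('m \<Rightarrow> 'e) \<Rightarrow> ('m \<Rightarrow> 'e) \<Rightarrow> 'm \<Rightarrow> 'e) \<Rightarrow> bool" where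
  "metric_compatible A g nabla \<longleftrightarrow>
     (\<forall>X Y Z. smooth_vector_field A X \<and> smooth_vector_field A Y \<and> smooth_vector_field A Z \<longrightarrow>
        deriv_along A X (\<lambda>x. g x (Y x) (Z x)) =
          (\<lambda>x. g x (nabla X Y x) (Z x) + g x (Y x) (nabla X Z x)))"

text \<open>The values of \<open>nabla\<close> on non-smooth arguments are left unspecified.\<close>

definition levi_civita :: "('m, 'e::euclidean_space) chart set \<Rightarrow>
    ('m \<Rightarrow> 'e \<Rightarrow> 'e \<Rightarrow> real) \<Rightarrow> (('m \<Rightarrow> 'e) \<Rightarrow> ('m \<Rightarrow> 'e) \<Rightarrow> 'm \<Rightarrow> 'e) \<Rightarrow> bool" where
  "levi_civita A g nabla \<longleftrightarrow>
     affine_connection A nabla \<and> torsion_free A nabla \<and> metric_compatible A g nabla"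

text \<open>\<open>(nabla_X S) Y\<close> for a field \<open>S\<close> of endomorphisms.\<close>

definition cov_deriv_tensor11 :: "(('m \<Rightarrow> 'e) \<Rightarrow> ('m \<Rightarrow> 'e) \<Rightarrow> 'm \<Rightarrow> 'e) \<Rightarrow>
    ('m \<Rightarrow> 'e \<Rightarrow> 'e::euclidean_space) \<Rightarrow> ('m \<Rightarrow> 'e) \<Rightarrow> ('m \<Rightarrow> 'e) \<Rightarrow> 'm \<Rightarrow> 'e" where
  "cov_deriv_tensor11 nabla S X Y =
     (\<lambda>x. nabla X (\<lambda>z. S z (Y z)) x - S x (nabla X Y x))"

section \<open>Metallic Riemannian manifolds and slant submanifolds\<close>

definition metallic_riemannian_manifold ::
    "('n::{t2_space, second_countable_topology}, 'f::euclidean_space) chart set \<Rightarrow>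
     ('n \<Rightarrow> 'f \<Rightarrow> 'f) \<Rightarrow> ('n \<Rightarrow> 'f \<Rightarrow> 'f \<Rightarrow> real) \<Rightarrow> nat \<Rightarrow> nat \<Rightarrow> bool" where
  "metallic_riemannian_manifold B J g p q \<longleftrightarrow>
     smooth_manifold B \<and> riemannian_metric B g \<and> tensor11_field B J \<and> p > 0 \<and> q > 0 \<and>
     (\<forall>x u. J x (J x u) = real p *\<^sub>R J x u + real q *\<^sub>R u) \<and>
     (\<forall>x u v. g x (J x u) v = g x u (J x v))"

definition immersion :: "('m::topological_space, 'e::euclidean_space) chart set \<Rightarrow>
    ('n::topological_space, 'f::euclidean_space) chart set \<Rightarrow> ('m \<Rightarrow> 'n) \<Rightarrow> bool" where
  "immersion A B f \<longleftrightarrow> smooth_map A B f \<and> (\<forall>x. inj (differential A B f x))"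

definition induced_metric :: "('m, 'e::euclidean_space) chart set \<Rightarrow>
    ('n, 'f::euclidean_space) chart set \<Rightarrow> ('m \<Rightarrow> 'n) \<Rightarrow> ('n \<Rightarrow> 'f \<Rightarrow> 'f \<Rightarrow> real) \<Rightarrow>
    'm \<Rightarrow> 'e \<Rightarrow> 'e \<Rightarrow> real" where
  "induced_metric A B f g x u v = g (f x) (differential A B f x u) (differential A B f x v)"

text \<open>The component tangent to the immersed manifold of an ambient vector \<open>w\<close> at \<open>f x\<close>, as an element of
  the tangent space at \<open>x\<close>: the \<open>u\<close> for which \<open>w - df u\<close> is normal.\<close>

definition tangential :: "('m, 'e::euclidean_space) chart set \<Rightarrow>
    ('n, 'f::euclidean_space) chart set \<Rightarrow> ('m \<Rightarrow> 'n) \<Rightarrow> ('n \<Rightarrow> 'f \<Rightarrow> 'f \<Rightarrow> real) \<Rightarrow>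
    'm \<Rightarrow> 'f \<Rightarrow> 'e" where
  "tangential A B f g x w =
     (THE u. \<forall>v. g (f x) (w - differential A B f x u) (differential A B f x v) = 0)"

definition tangential_part :: "('m, 'e::euclidean_space) chart set \<Rightarrow>
    ('n, 'f::euclidean_space) chart set \<Rightarrow> ('m \<Rightarrow> 'n) \<Rightarrow> ('n \<Rightarrow> 'f \<Rightarrow> 'f \<Rightarrow> real) \<Rightarrow>
    ('n \<Rightarrow> 'f \<Rightarrow> 'f) \<Rightarrow> 'm \<Rightarrow> 'e \<Rightarrow> 'e" where
  "tangential_part A B f g J x u = tangential A B f g x (J (f x) (differential A B f x u))"

definition vector_angle :: "('f \<Rightarrow> 'f \<Rightarrow> real) \<Rightarrow> 'f \<Rightarrow> 'f \<Rightarrow> real" where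
  "vector_angle b u v = arccos (b u v / (sqrt (b u u) * sqrt (b v v)))"

text \<open>The smallest angle between \<open>w\<close> and a nonzero vector of the subspace \<open>V\<close>.\<close>

definition subspace_angle :: "('f \<Rightarrow> 'f \<Rightarrow> real) \<Rightarrow> 'f \<Rightarrow> 'f::euclidean_space set \<Rightarrow> real" where
  "subspace_angle b w V = (INF v \<in> V - {0}. vector_angle b w v)"

definition slant :: "('m, 'e::euclidean_space) chart set \<Rightarrow>
    ('n, 'f::euclidean_space) chart set \<Rightarrow> ('m \<Rightarrow> 'n) \<Rightarrow> ('n \<Rightarrow> 'f \<Rightarrow> 'f \<Rightarrow> real) \<Rightarrow>
    ('n \<Rightarrow> 'f \<Rightarrow> 'f) \<Rightarrow> real \<Rightarrow> bool" where
  "slant A B f g J \<theta> \<longleftrightarrow>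
     (\<forall>x u. u \<noteq> 0 \<longrightarrow>
        subspace_angle (g (f x)) (J (f x) (differential A B f x u))
          (range (differential A B f x)) = \<theta>)"

end

theory Submission
  imports Defs
begin

text \<open>
  The algebra takes place in one tangent space. Let \<open>c = (cos \<theta>)\<^sup>2\<close>. The angle between
  \<open>JU\<close> and the tangent space has cosine \<open>\<bar>TU\<bar> / \<bar>JU\<bar>\<close>, because \<open>TU\<close> is the orthogonal projection
  of \<open>JU\<close>; slantness thus says \<open>g(TU, TU) = c g(JU, JU)\<close> for every tangent \<open>U\<close>
  (lemma \<open>cos_subspace_angle\<close>). Both sides are quadratic forms in \<open>U\<close>, so polarisation gives \<open>g(TU, TV) = c g(JU, JV)\<close>. As \<open>J\<close>, and hence \<open>T\<close>,
  is self-adjoint, this reads \<open>g(T\<^sup>2U, V) = c g(J\<^sup>2U, V) = c g(pJU + qU, V)\<close>, and only the tangential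
  part of \<open>JU\<close> contributes on the right, so that
  \<open>T\<^sup>2 = c (pT + qI)\<close> (lemma \<open>slant_projection_square\<close>). The coefficients are constants, because the
  slant angle does not depend on the point. Hence \<open>\<nabla>\<^sub>X\<close> may be applied to \<open>T\<^sup>2Y = cp TY + cq Y\<close> term by
  term, the terms with \<open>q\<close> cancel in \<open>\<nabla>\<^sub>X(T\<^sup>2Y) - T\<^sup>2(\<nabla>\<^sub>XY)\<close>, and \<open>cp (\<nabla>\<^sub>XT)Y\<close> remains.

  A connection is additive and satisfies the Leibniz rule only on smooth fields, so that last step
  also needs \<open>TY\<close> to be smooth (lemma \<open>smooth_vector_field_tangential_part\<close>). This is where most of the
  work lies. In a chart with coordinate fields \<open>E\<^sub>i\<close>, the components \<open>W\<^sub>j\<close> of \<open>TY\<close>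
  solve the linear system \<open>\<Sum>\<^sub>j g(E\<^sub>j, E\<^sub>i) W\<^sub>j = g(JY, E\<^sub>i)\<close>, whose coefficients are smooth and whose
  matrix is positive definite; elimination solves such a system by rational operations
  without ever dividing by zero (lemma \<open>smooth_on_positive_definite_solution\<close>). That the
  coefficients are smooth follows from the chain rule for Jacobians with respect to charts
  (lemma \<open>chart_jacobian_compose\<close>) and from the closure of smooth maps under the usual operations.
\<close>

section \<open>Calculus of smooth maps between Euclidean spaces\<close>

lemma linear_expand_Basis:
  assumes "linear L"
  shows "L v = (\<Sum>i\<in>Basis. (v \<bullet> i) *\<^sub>R L i)"
proof -
  have "L v = L (\<Sum>i\<in>Basis. (v \<bullet> i) *\<^sub>R i)"
    by (simp add: euclidean_representation)
  also have "\<dots> = (\<Sum>i\<in>Basis. (v \<bullet> i) *\<^sub>R L i)"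
    by (simp add: linear_sum[OF assms] linear_cmul[OF assms])
  finally show ?thesis .
qed

text \<open>The derivative at a point of an open set is determined by the values on that set, so modifying the
  map outside \<open>S\<close> is harmless.\<close>

lemma Ck_on_cong:
  assumes "open S" and "\<And>x. x \<in> S \<Longrightarrow> f x = g x" and "Ck_on k S f"
  shows "Ck_on k S g"
  using assms(2,3)
proof (induction k arbitrary: f g)
  case 0
  then show ?case using continuous_on_cong[of S S f g] by simp
next
  case (Suc k)
  have d: "f differentiable at x" if "x \<in> S" for x
    using Suc.prems that by simp
  have eq: "(g has_derivative frechet_derivative f (at x)) (at x)" if "x \<in> S" for x
    using d[OF that] unfolding frechet_derivative_works
    by (rule has_derivative_transform_within_open[OF _ assms(1) that Suc.prems(1)])
  have "Ck_on k S (\<lambda>x. frechet_derivative g (at x) v)" for v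
  proof (rule Suc.IH)
    show "Ck_on k S (\<lambda>x. frechet_derivative f (at x) v)"
      using Suc.prems(2) by simp
    show "frechet_derivative f (at x) v = frechet_derivative g (at x) v" if "x \<in> S" for x
      using frechet_derivative_at[OF eq[OF that]] by simp
  qed
  then show ?case
    using differentiableI[OF eq] by simp
qed

text \<open>Lets each closure property below be proved by exhibiting the derivative from the usual
  differentiation rule, instead of computing with \<open>frechet_derivative\<close>.\<close>

lemma Ck_on_SucI:
  assumes "open S" and "\<And>x. x \<in> S \<Longrightarrow> (f has_derivative f' x) (at x)"
    and "\<And>v. Ck_on k S (\<lambda>x. f' x v)"
  shows "Ck_on (Suc k) S f"
proof -
  have "Ck_on k S (\<lambda>x. frechet_derivative f (at x) v)" for v
    by (rule Ck_on_cong[OF assms(1) _ assms(3)[of v]])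
       (use frechet_derivative_at[OF assms(2)] in simp)
  then show ?thesis
    using differentiableI[OF assms(2)] by simp
qed

lemma Ck_on_Suc_has_derivative:
  assumes "Ck_on (Suc k) S f" and "x \<in> S"
  shows "(f has_derivative frechet_derivative f (at x)) (at x)"
  using assms by (simp add: frechet_derivative_works[symmetric])

lemma Ck_on_SucD: "Ck_on (Suc k) S f \<Longrightarrow> Ck_on k S f"
proof (induction k arbitrary: f)
  case 0
  then show ?case
    by (simp add: continuous_at_imp_continuous_on differentiable_imp_continuous_within)
next
  case (Suc k)
  have "Ck_on (Suc k) S (\<lambda>x. frechet_derivative f (at x) v)" for v
    using Suc.prems by simp
  then have "Ck_on k S (\<lambda>x. frechet_derivative f (at x) v)" for v
    by (rule Suc.IH)
  then show ?case
    using Suc.prems by simp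
qed

lemma Ck_on_subset: "Ck_on k S f \<Longrightarrow> U \<subseteq> S \<Longrightarrow> Ck_on k U f"
proof (induction k arbitrary: f)
  case 0
  then show ?case by (simp add: continuous_on_subset)
next
  case (Suc k)
  then show ?case by (simp add: subset_iff)
qed

text \<open>Smoothness of a field is demanded on the whole range of a chart, but a map into another manifold
  has a coordinate expression only near a point.\<close>

lemma Ck_on_local:
  assumes "\<And>x. x \<in> S \<Longrightarrow> \<exists>U. open U \<and> x \<in> U \<and> Ck_on k U f"
  shows "Ck_on k S f"
  using assms
proof (induction k arbitrary: f)
  case 0
  then have "isCont f x" if "x \<in> S" for x
    using that by (metis Ck_on.simps(1) continuous_on_eq_continuous_at)
  then show ?case
    by (simp add: continuous_at_imp_continuous_on)
next
  case (Suc k)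
  have "Ck_on k S (\<lambda>x. frechet_derivative f (at x) v)" for v
    by (rule Suc.IH) (use Suc.prems in fastforce)
  moreover have "f differentiable at x" if "x \<in> S" for x
    using Suc.prems[OF that] by auto
  ultimately show ?case by simp
qed

lemma Ck_on_const: "Ck_on k S (\<lambda>x. c)"
  by (induction k arbitrary: c) simp_all

lemma Ck_on_bounded_linear:
  assumes "open S" and "bounded_linear L" and "Ck_on k S f"
  shows "Ck_on k S (\<lambda>x. L (f x))"
  using assms(3)
proof (induction k arbitrary: f)
  case 0
  then show ?case
    using bounded_linear.continuous_on[OF assms(2)] by simp
next
  case (Suc k)
  show ?case
  proof (rule Ck_on_SucI[OF assms(1)])
    show "((\<lambda>x. L (f x)) has_derivative (\<lambda>v. L (frechet_derivative f (at x) v))) (at x)"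
      if "x \<in> S" for x
      using bounded_linear.has_derivative[OF assms(2)] Ck_on_Suc_has_derivative[OF Suc.prems that]
      by blast
    show "Ck_on k S (\<lambda>x. L (frechet_derivative f (at x) v))" for v
      using Suc.prems by (intro Suc.IH) simp
  qed
qed

lemma Ck_on_add:
  assumes "open S" and "Ck_on k S f" and "Ck_on k S g"
  shows "Ck_on k S (\<lambda>x. f x + g x)"
  using assms(2,3)
proof (induction k arbitrary: f g)
  case 0
  then show ?case by (simp add: continuous_on_add)
next
  case (Suc k)
  show ?case
  proof (rule Ck_on_SucI[OF assms(1)])
    show "((\<lambda>x. f x + g x) has_derivative
        (\<lambda>v. frechet_derivative f (at x) v + frechet_derivative g (at x) v)) (at x)"
      if "x \<in> S" for x
      using Ck_on_Suc_has_derivative[OF Suc.prems(1) that]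
        Ck_on_Suc_has_derivative[OF Suc.prems(2) that] by (rule has_derivative_add)
    show "Ck_on k S (\<lambda>x. frechet_derivative f (at x) v + frechet_derivative g (at x) v)" for v
      using Suc.prems by (intro Suc.IH) simp_all
  qed
qed

lemma Ck_on_sum:
  assumes "open S" and "\<And>i. i \<in> I \<Longrightarrow> Ck_on k S (f i)"
  shows "Ck_on k S (\<lambda>x. \<Sum>i\<in>I. f i x)"
  using assms(2)
  by (induction I rule: infinite_finite_induct) (auto intro: Ck_on_const Ck_on_add[OF assms(1)])

lemma Ck_on_bounded_bilinear:
  assumes "open S" and "bounded_bilinear P" and "Ck_on k S f" and "Ck_on k S g"
  shows "Ck_on k S (\<lambda>x. P (f x) (g x))"
  using assms(3,4)
proof (induction k arbitrary: f g)
  case 0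
  then show ?case
    using bounded_bilinear.continuous_on[OF assms(2)] by simp
next
  case (Suc k)
  show ?case
  proof (rule Ck_on_SucI[OF assms(1)])
    show "((\<lambda>x. P (f x) (g x)) has_derivative
        (\<lambda>v. P (f x) (frechet_derivative g (at x) v) + P (frechet_derivative f (at x) v) (g x)))
        (at x)" if "x \<in> S" for x
      using bounded_bilinear.FDERIV[OF assms(2)] Ck_on_Suc_has_derivative[OF Suc.prems(1) that]
        Ck_on_Suc_has_derivative[OF Suc.prems(2) that] by blast
    show "Ck_on k S (\<lambda>x. P (f x) (frechet_derivative g (at x) v)
        + P (frechet_derivative f (at x) v) (g x))" for v
      using Suc.prems Ck_on_SucD[OF Suc.prems(1)] Ck_on_SucD[OF Suc.prems(2)]
      by (intro Ck_on_add[OF assms(1)] Suc.IH) simp_all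
  qed
qed

text \<open>The derivative of \<open>g \<circ> f\<close> in direction \<open>v\<close> must be rewritten as a finite sum over a basis:
  the regularity of \<open>\<lambda>z. frechet_derivative g (at z) w\<close> is known only for a fixed direction \<open>w\<close>,
  whereas the direction \<open>frechet_derivative f (at x) v\<close> moves with \<open>x\<close>.\<close>

lemma Ck_on_compose:
  assumes "open S" and "open U" and "f ` S \<subseteq> U" and "Ck_on k S f" and "Ck_on k U g"
  shows "Ck_on k S (\<lambda>x. g (f x))"
  using assms(4,5)
proof (induction k arbitrary: g)
  case 0
  then show ?case
    using continuous_on_compose2[OF _ _ assms(3)] by simp
next
  case (Suc k)
  let ?D = "\<lambda>x v. \<Sum>b\<in>Basis. (frechet_derivative f (at x) v \<bullet> b) *\<^sub>R frechet_derivative g (at (f x)) b"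
  show ?case
  proof (rule Ck_on_SucI[OF assms(1)])
    fix x assume x: "x \<in> S"
    have f: "(f has_derivative frechet_derivative f (at x)) (at x)"
      using Ck_on_Suc_has_derivative[OF Suc.prems(1) x] .
    have g: "(g has_derivative frechet_derivative g (at (f x))) (at (f x))"
      using Ck_on_Suc_has_derivative[OF Suc.prems(2)] x assms(3) by blast
    note expand = linear_expand_Basis[OF has_derivative_linear[OF g]]
    have "?D x = (\<lambda>v. frechet_derivative g (at (f x)) (frechet_derivative f (at x) v))"
      by (intro ext expand[symmetric])
    then show "((\<lambda>x. g (f x)) has_derivative ?D x) (at x)"
      using has_derivative_compose[OF f g] by simp
  next
    fix v
    show "Ck_on k S (\<lambda>x. ?D x v)"
    proof (intro Ck_on_sum[OF assms(1)] Ck_on_bounded_bilinear[OF assms(1) bounded_bilinear_scaleR])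
      fix b :: 'b
      show "Ck_on k S (\<lambda>x. frechet_derivative f (at x) v \<bullet> b)"
        using Suc.prems(1) by (intro Ck_on_bounded_linear[OF assms(1) bounded_linear_inner_left]) simp
      show "Ck_on k S (\<lambda>x. frechet_derivative g (at (f x)) b)"
        by (rule Suc.IH[OF Ck_on_SucD[OF Suc.prems(1)]]) (use Suc.prems(2) in simp)
    qed
  qed
qed

lemma Ck_on_inverse:
  fixes h :: "'a::euclidean_space \<Rightarrow> real"
  assumes "open S" and "Ck_on k S h" and "\<And>x. x \<in> S \<Longrightarrow> h x \<noteq> 0"
  shows "Ck_on k S (\<lambda>x. inverse (h x))"
  using assms(2)
proof (induction k)
  case 0
  then show ?case using assms(3) by (auto intro: continuous_on_inverse)
next
  case (Suc k)
  show ?case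
  proof (rule Ck_on_SucI[OF assms(1)])
    show "((\<lambda>x. inverse (h x)) has_derivative
        (\<lambda>v. - (inverse (h x) * frechet_derivative h (at x) v * inverse (h x)))) (at x)"
      if "x \<in> S" for x
      using Deriv.has_derivative_inverse[OF assms(3)[OF that] Ck_on_Suc_has_derivative[OF Suc.prems that]] .
    have inv: "Ck_on k S (\<lambda>x. inverse (h x))"
      using Suc.IH Ck_on_SucD[OF Suc.prems] .
    show "Ck_on k S (\<lambda>x. - (inverse (h x) * frechet_derivative h (at x) v * inverse (h x)))" for v
    proof -
      have dh: "Ck_on k S (\<lambda>x. frechet_derivative h (at x) v)"
        using Suc.prems by simp
      note mult = Ck_on_bounded_bilinear[OF assms(1) bounded_bilinear_mult]
      show ?thesis
        using mult[OF mult[OF inv dh] inv]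
        by (rule Ck_on_bounded_linear[OF assms(1) bounded_linear_minus[OF bounded_linear_ident]])
    qed
  qed
qed

lemma smooth_on_cong:
  assumes "open S" and "\<And>x. x \<in> S \<Longrightarrow> f x = g x" and "smooth_on S f"
  shows "smooth_on S g"
  using Ck_on_cong[OF assms(1,2)] assms(3) by (simp add: smooth_on_def)

lemma smooth_on_subset: "smooth_on S f \<Longrightarrow> U \<subseteq> S \<Longrightarrow> smooth_on U f"
  using Ck_on_subset[of _ S f U] by (simp add: smooth_on_def)

lemma smooth_on_local:
  assumes "\<And>x. x \<in> S \<Longrightarrow> \<exists>U. open U \<and> x \<in> U \<and> smooth_on U f"
  shows "smooth_on S f"
  unfolding smooth_on_def using assms by (meson Ck_on_local smooth_on_def)

lemma smooth_on_const: "smooth_on S (\<lambda>x. c)"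
  by (simp add: smooth_on_def Ck_on_const)

lemma smooth_on_bounded_linear:
  "open S \<Longrightarrow> bounded_linear L \<Longrightarrow> smooth_on S f \<Longrightarrow> smooth_on S (\<lambda>x. L (f x))"
  using Ck_on_bounded_linear[of S L _ f] by (simp add: smooth_on_def)

lemma smooth_on_sum:
  "open S \<Longrightarrow> (\<And>i. i \<in> I \<Longrightarrow> smooth_on S (f i)) \<Longrightarrow> smooth_on S (\<lambda>x. \<Sum>i\<in>I. f i x)"
  by (simp add: smooth_on_def Ck_on_sum)

lemma smooth_on_add:
  "open S \<Longrightarrow> smooth_on S f \<Longrightarrow> smooth_on S g \<Longrightarrow> smooth_on S (\<lambda>x. f x + g x)"
  by (simp add: smooth_on_def Ck_on_add)

lemma smooth_on_scaleR:
  "open S \<Longrightarrow> smooth_on S h \<Longrightarrow> smooth_on S f \<Longrightarrow> smooth_on S (\<lambda>x. h x *\<^sub>R f x)"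
  by (simp add: smooth_on_def Ck_on_bounded_bilinear[OF _ bounded_bilinear_scaleR])

lemma smooth_on_mult:
  fixes f h :: "'a::euclidean_space \<Rightarrow> real"
  shows "open S \<Longrightarrow> smooth_on S f \<Longrightarrow> smooth_on S h \<Longrightarrow> smooth_on S (\<lambda>x. f x * h x)"
  by (simp add: smooth_on_def Ck_on_bounded_bilinear[OF _ bounded_bilinear_mult])

lemma smooth_on_diff:
  assumes "open S" and "smooth_on S f" and "smooth_on S g"
  shows "smooth_on S (\<lambda>x. f x - g x)"
proof -
  have "smooth_on S (\<lambda>x. - g x)"
    by (rule smooth_on_bounded_linear[OF assms(1) bounded_linear_minus[OF bounded_linear_ident] assms(3)])
  then have "smooth_on S (\<lambda>x. f x + - g x)"
    by (rule smooth_on_add[OF assms(1,2)])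
  then show ?thesis by simp
qed

lemma smooth_on_divide:
  fixes f h :: "'a::euclidean_space \<Rightarrow> real"
  assumes "open S" and "smooth_on S f" and "smooth_on S h" and "\<And>x. x \<in> S \<Longrightarrow> h x \<noteq> 0"
  shows "smooth_on S (\<lambda>x. f x / h x)"
proof -
  have "smooth_on S (\<lambda>x. inverse (h x))"
    using assms(3,4) Ck_on_inverse[OF assms(1)] by (simp add: smooth_on_def)
  then show ?thesis
    using smooth_on_mult[OF assms(1,2)] by (simp add: divide_inverse)
qed

lemma smooth_on_inner:
  "open S \<Longrightarrow> smooth_on S f \<Longrightarrow> smooth_on S (\<lambda>x. f x \<bullet> b)"
  by (rule smooth_on_bounded_linear[OF _ bounded_linear_inner_left])

lemma smooth_on_compose:
  "open S \<Longrightarrow> open U \<Longrightarrow> f ` S \<subseteq> U \<Longrightarrow> smooth_on S f \<Longrightarrow> smooth_on U g \<Longrightarrow>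
    smooth_on S (\<lambda>x. g (f x))"
  using Ck_on_compose[of S U f _ g] by (simp add: smooth_on_def)

lemma smooth_on_frechet_derivative:
  assumes "smooth_on S f"
  shows "smooth_on S (\<lambda>x. frechet_derivative f (at x) v)"
  unfolding smooth_on_def
proof
  fix k
  have "Ck_on (Suc k) S f" using assms smooth_on_def by blast
  then show "Ck_on k S (\<lambda>x. frechet_derivative f (at x) v)" by simp
qed

lemma smooth_on_has_derivative:
  assumes "smooth_on S f" and "x \<in> S"
  shows "(f has_derivative frechet_derivative f (at x)) (at x)"
proof (rule Ck_on_Suc_has_derivative)
  show "Ck_on (Suc 0) S f"
    using assms(1) unfolding smooth_on_def by (rule spec)
qed (rule assms(2))

text \<open>Tensors are known to be smooth when applied to constant coordinate vectors; expanding in a basis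
  extends this to variable ones.\<close>

lemma smooth_on_apply_linear:
  assumes "open S" and "\<And>y. y \<in> S \<Longrightarrow> linear (L y)"
    and "\<And>u. smooth_on S (\<lambda>y. L y u)" and "smooth_on S v"
  shows "smooth_on S (\<lambda>y. L y (v y))"
proof (rule smooth_on_cong[OF assms(1)])
  show "smooth_on S (\<lambda>y. \<Sum>i\<in>Basis. (v y \<bullet> i) *\<^sub>R L y i)"
    by (intro smooth_on_sum smooth_on_scaleR smooth_on_inner assms)
  show "(\<Sum>i\<in>Basis. (v y \<bullet> i) *\<^sub>R L y i) = L y (v y)" if "y \<in> S" for y
    by (rule linear_expand_Basis[OF assms(2)[OF that], symmetric])
qed

section \<open>Positive definite linear systems with smooth coefficients\<close>

text \<open>Gaussian elimination. The pivot \<open>M k k\<close> is positive, being the quadratic form at a unit vector.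
  Eliminating the unknown \<open>W k\<close> leaves the Schur complement \<open>M i j - M i k * M k j / M k k\<close>, which is
  again smooth and positive definite, so induction on the number of unknowns applies; \<open>W k\<close> is then
  recovered from row \<open>k\<close>.\<close>

lemma smooth_on_positive_definite_solution:
  fixes M :: "'i \<Rightarrow> 'i \<Rightarrow> 'a::euclidean_space \<Rightarrow> real"
  assumes "open S" and "finite K"
    and "\<And>i j. i \<in> K \<Longrightarrow> j \<in> K \<Longrightarrow> smooth_on S (M i j)"
    and "\<And>i. i \<in> K \<Longrightarrow> smooth_on S (R i)"
    and "\<And>y c. y \<in> S \<Longrightarrow> \<exists>i\<in>K. c i \<noteq> 0 \<Longrightarrow> (\<Sum>i\<in>K. c i * (\<Sum>j\<in>K. M i j y * c j)) > 0"
    and "\<And>y i. y \<in> S \<Longrightarrow> i \<in> K \<Longrightarrow> (\<Sum>j\<in>K. M i j y * W j y) = R i y"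
    and "l \<in> K"
  shows "smooth_on S (W l)"
  using assms(2-)
proof (induction K arbitrary: M R l rule: finite_induct)
  case empty
  then show ?case by simp
next
  case (insert k K)
  note fin = insert.hyps(1) and k = insert.hyps(2)
  note M = insert.prems(1) and R = insert.prems(2) and pos = insert.prems(3) and eq = insert.prems(4)
  have sums: "(\<Sum>j\<in>insert k K. h j) = h k + (\<Sum>j\<in>K. h j)" for h :: "'i \<Rightarrow> real"
    using fin k by simp
  have split: "(\<Sum>i\<in>insert k K. c i * (\<Sum>j\<in>insert k K. M i j y * c j))
      = c k * (M k k y * c k + (\<Sum>j\<in>K. M k j y * c j))
        + (\<Sum>i\<in>K. c i * (M i k y * c k + (\<Sum>j\<in>K. M i j y * c j)))" for c y
    by (simp only: sums)
  have Mkk: "M k k y > 0" if "y \<in> S" for y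
  proof -
    define c :: "'i \<Rightarrow> real" where "c i = (if i = k then 1 else 0)" for i
    have "c k = 1" and "\<And>i. i \<in> K \<Longrightarrow> c i = 0"
      using k by (auto simp: c_def)
    then show ?thesis
      using pos[OF that, of c] unfolding split by simp
  qed
  define M' where "M' i j y = M i j y - M i k y * M k j y / M k k y" for i j y
  define R' where "R' i y = R i y - M i k y * R k y / M k k y" for i y
  have M'_row: "(\<Sum>j\<in>K. M' i j y * c j)
      = (\<Sum>j\<in>K. M i j y * c j) - M i k y * (\<Sum>j\<in>K. M k j y * c j) / M k k y" for i y c
    by (simp add: M'_def left_diff_distrib sum_subtractf sum_distrib_left sum_divide_distrib mult.assoc)
  have W: "smooth_on S (W i)" if "i \<in> K" for i
  proof (rule insert.IH[of M' R'])
    show "smooth_on S (M' i j)" if "i \<in> K" "j \<in> K" for i j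
      unfolding M'_def using that Mkk
      by (intro smooth_on_diff smooth_on_divide smooth_on_mult assms(1) M) (auto simp: less_imp_neq[symmetric])
    show "smooth_on S (R' i)" if "i \<in> K" for i
      unfolding R'_def using that Mkk
      by (intro smooth_on_diff smooth_on_divide smooth_on_mult assms(1) M R) (auto simp: less_imp_neq[symmetric])
    show "(\<Sum>i\<in>K. c i * (\<Sum>j\<in>K. M' i j y * c j)) > 0" if y: "y \<in> S" and c: "\<exists>i\<in>K. c i \<noteq> 0" for y c
    proof -
      \<comment> \<open>Extend \<open>c\<close> so that row \<open>k\<close> of the product vanishes; the two quadratic forms then agree.\<close>
      define d where "d = c(k := - (\<Sum>j\<in>K. M k j y * c j) / M k k y)"
      have dK: "d j = c j" if "j \<in> K" for j
        using that k by (auto simp: d_def)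
      have rows: "(\<Sum>j\<in>K. M i j y * d j) = (\<Sum>j\<in>K. M i j y * c j)" for i
        by (rule sum.cong) (auto simp: dK)
      have dk: "d k = - (\<Sum>j\<in>K. M k j y * c j) / M k k y"
        by (simp add: d_def)
      have "(\<Sum>i\<in>insert k K. d i * (\<Sum>j\<in>insert k K. M i j y * d j)) > 0"
        using c dK by (intro pos[OF y]) auto
      also have "(\<Sum>i\<in>insert k K. d i * (\<Sum>j\<in>insert k K. M i j y * d j))
          = (\<Sum>i\<in>K. c i * (M i k y * d k + (\<Sum>j\<in>K. M i j y * c j)))"
        unfolding split rows using Mkk[OF y] by (simp add: dk dK)
      also have "\<dots> = (\<Sum>i\<in>K. c i * (\<Sum>j\<in>K. M' i j y * c j))"
        unfolding M'_row dk by (simp add: algebra_simps)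
      finally show ?thesis .
    qed
    show "(\<Sum>j\<in>K. M' i j y * W j y) = R' i y" if y: "y \<in> S" and i: "i \<in> K" for y i
    proof -
      have 1: "M i k y * W k y + (\<Sum>j\<in>K. M i j y * W j y) = R i y"
        using eq[OF y, of i] i unfolding sums by simp
      have 2: "M k k y * W k y + (\<Sum>j\<in>K. M k j y * W j y) = R k y"
        using eq[OF y, of k] unfolding sums by simp
      show ?thesis
        unfolding M'_row R'_def 1[symmetric] 2[symmetric] using Mkk[OF y]
        by (simp add: field_simps)
    qed
    show "i \<in> K" by fact
  qed
  have "smooth_on S (\<lambda>y. (R k y - (\<Sum>j\<in>K. M k j y * W j y)) / M k k y)"
    using Mkk W
    by (intro smooth_on_diff smooth_on_divide smooth_on_sum smooth_on_mult assms(1) M R)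
       (auto simp: less_imp_neq[symmetric])
  then have "smooth_on S (W k)"
  proof (rule smooth_on_cong[OF assms(1), rotated])
    fix y assume y: "y \<in> S"
    then show "(R k y - (\<Sum>j\<in>K. M k j y * W j y)) / M k k y = W k y"
      using eq[OF y, of k] Mkk[OF y] unfolding sums by (simp add: field_simps)
  qed
  then show ?case
    using W insert.prems(5) by blast
qed

section \<open>Charts and the chain rule on manifolds\<close>

lemma chart_at_in:
  assumes "smooth_manifold A"
  shows "chart_at A x \<in> A" and "x \<in> chart_dom (chart_at A x)"
proof -
  have "\<exists>c. c \<in> A \<and> x \<in> chart_dom c"
    using assms unfolding smooth_manifold_def by blast
  then have "chart_at A x \<in> A \<and> x \<in> chart_dom (chart_at A x)"
    unfolding chart_at_def by (rule someI_ex)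
  then show "chart_at A x \<in> A" and "x \<in> chart_dom (chart_at A x)" by auto
qed

context
  fixes A :: "('m::{t2_space, second_countable_topology}, 'e::euclidean_space) chart set" and c
  assumes A: "smooth_manifold A" and c: "c \<in> A"
begin

lemma open_chart_dom: "open (chart_dom c)"
  and open_chart_ran: "open (chart_ran c)"
  and homeomorphism_chart: "homeomorphism (chart_dom c) (chart_ran c) (coord c) (param c)"
  using A c unfolding smooth_manifold_def by auto

lemma param_coord: "x \<in> chart_dom c \<Longrightarrow> param c (coord c x) = x"
  using homeomorphism_chart by (rule homeomorphism_apply1)

lemma coord_param: "y \<in> chart_ran c \<Longrightarrow> coord c (param c y) = y"
  using homeomorphism_chart by (rule homeomorphism_apply2)

lemma param_in_chart_dom: "y \<in> chart_ran c \<Longrightarrow> param c y \<in> chart_dom c"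
  using homeomorphism_image2[OF homeomorphism_chart] by blast

lemma open_coord_image:
  assumes "open V"
  shows "open (coord c ` (chart_dom c \<inter> V))"
proof -
  have "openin (top_of_set (chart_dom c)) (chart_dom c \<inter> V)"
    using assms by (rule openin_open_Int)
  then have "openin (top_of_set (chart_ran c)) (coord c ` (chart_dom c \<inter> V))"
    by (rule homeomorphism_imp_open_map[OF homeomorphism_chart])
  then show ?thesis
    using open_chart_ran openin_open_trans by blast
qed

end

lemma smooth_map_id:
  assumes "smooth_manifold A"
  shows "smooth_map A A id"
  using assms unfolding smooth_manifold_def smooth_map_def by simp

definition chart_jacobian :: "('m, 'e::euclidean_space) chart \<Rightarrow> ('n, 'f::euclidean_space) chart \<Rightarrow>
    ('m \<Rightarrow> 'n) \<Rightarrow> 'm \<Rightarrow> 'e \<Rightarrow> 'f" where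
  "chart_jacobian a b f x = frechet_derivative (coord b \<circ> f \<circ> param a) (at (coord a x))"

lemma open_local_rep_domain:
  assumes "smooth_manifold A" "smooth_manifold B" "smooth_map A B f" "a \<in> A" "b \<in> B"
  shows "open (coord a ` (chart_dom a \<inter> f -` chart_dom b))"
proof -
  have "open (f -` chart_dom b)"
    using assms(3) open_chart_dom[OF assms(2,5)]
    by (intro open_vimage) (auto simp: smooth_map_def)
  then show ?thesis by (rule open_coord_image[OF assms(1,4)])
qed

lemma chart_jacobian_has_derivative:
  assumes "smooth_manifold A" "smooth_manifold B" "smooth_map A B f" "a \<in> A" "b \<in> B"
    and "x \<in> chart_dom a" "f x \<in> chart_dom b"
  shows "((coord b \<circ> f \<circ> param a) has_derivative chart_jacobian a b f x) (at (coord a x))"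
  unfolding chart_jacobian_def
proof (rule smooth_on_has_derivative)
  show "smooth_on (coord a ` (chart_dom a \<inter> f -` chart_dom b)) (coord b \<circ> f \<circ> param a)"
    using assms unfolding smooth_map_def by blast
qed (use assms in blast)

lemma linear_chart_jacobian:
  assumes "smooth_manifold A" "smooth_manifold B" "smooth_map A B f" "a \<in> A" "b \<in> B"
    and "x \<in> chart_dom a" "f x \<in> chart_dom b"
  shows "linear (chart_jacobian a b f x)"
  using chart_jacobian_has_derivative[OF assms] by (rule has_derivative_linear)

text \<open>Taking some of the maps to be \<open>id\<close>, this single rule yields all the transformation laws between
  the selected charts and the charts of the atlas.\<close>

lemma chart_jacobian_compose:
  assumes A: "smooth_manifold A" and B: "smooth_manifold B" and C: "smooth_manifold C"
    and f: "smooth_map A B f" and h: "smooth_map B C h"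
    and a: "a \<in> A" and b: "b \<in> B" and c: "c \<in> C"
    and x: "x \<in> chart_dom a" "f x \<in> chart_dom b" "h (f x) \<in> chart_dom c"
  shows "chart_jacobian a c (h \<circ> f) x = chart_jacobian b c h (f x) \<circ> chart_jacobian a b f x"
proof -
  let ?F = "coord b \<circ> f \<circ> param a" and ?H = "coord c \<circ> h \<circ> param b"
  let ?U = "coord a ` (chart_dom a \<inter> f -` chart_dom b)"
  have Fx: "?F (coord a x) = coord b (f x)"
    by (simp add: param_coord[OF A a x(1)])
  have "((?H \<circ> ?F) has_derivative (chart_jacobian b c h (f x) \<circ> chart_jacobian a b f x)) (at (coord a x))"
    using chart_jacobian_has_derivative[OF A B f a b x(1,2)] chart_jacobian_has_derivative[OF B C h b c x(2,3)]
    by (intro diff_chain_at) (simp_all add: Fx[simplified])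
  then have "((coord c \<circ> (h \<circ> f) \<circ> param a) has_derivative (chart_jacobian b c h (f x) \<circ> chart_jacobian a b f x))
      (at (coord a x))"
  proof (rule has_derivative_transform_within_open)
    show "open ?U" using A B f a b by (rule open_local_rep_domain)
    show "coord a x \<in> ?U" using x by blast
    show "(?H \<circ> ?F) y = (coord c \<circ> (h \<circ> f) \<circ> param a) y" if "y \<in> ?U" for y
      using that by (auto simp: param_coord[OF A a] param_coord[OF B b])
  qed
  then show ?thesis
    unfolding chart_jacobian_def[of a c] by (rule frechet_derivative_at[symmetric])
qed

lemma chart_jacobian_id:
  assumes A: "smooth_manifold A" and a: "a \<in> A" and x: "x \<in> chart_dom a"
  shows "chart_jacobian a a id x = id"
proof -
  have "((coord a \<circ> id \<circ> param a) has_derivative id) (at (coord a x))"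
  proof (rule has_derivative_transform_within_open)
    show "(id has_derivative id) (at (coord a x))"
      unfolding id_def by (rule has_derivative_ident)
    show "open (chart_ran a)" using A a by (rule open_chart_ran)
    show "coord a x \<in> chart_ran a" using x by (simp add: chart_ran_def)
    show "id y = (coord a \<circ> id \<circ> param a) y" if "y \<in> chart_ran a" for y
      using coord_param[OF A a that] by simp
  qed
  then show ?thesis
    unfolding chart_jacobian_def by (rule frechet_derivative_at[symmetric])
qed

text \<open>The three kinds of derivatives from which fields and immersions are built are all Jacobians of
  \<open>id\<close> or \<open>f\<close>, differing only in the charts used.\<close>

lemma to_chart_eq_chart_jacobian: "to_chart A c x = chart_jacobian (chart_at A x) c id x"
  by (simp add: to_chart_def chart_jacobian_def)

lemma from_chart_eq_chart_jacobian: "from_chart A c x = chart_jacobian c (chart_at A x) id x"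
  by (simp add: from_chart_def chart_jacobian_def)

lemma differential_eq_chart_jacobian: "differential A B f x = chart_jacobian (chart_at A x) (chart_at B (f x)) f x"
  by (simp add: differential_def chart_jacobian_def)

context
  fixes A :: "('m::{t2_space, second_countable_topology}, 'e::euclidean_space) chart set" and c x
  assumes A: "smooth_manifold A" and c: "c \<in> A" and x: "x \<in> chart_dom c"
begin

lemma linear_to_chart: "linear (to_chart A c x)"
  unfolding to_chart_eq_chart_jacobian
  by (rule linear_chart_jacobian[OF A A smooth_map_id[OF A]]) (simp_all add: chart_at_in[OF A] c x)

lemma linear_from_chart: "linear (from_chart A c x)"
  unfolding from_chart_eq_chart_jacobian
  by (rule linear_chart_jacobian[OF A A smooth_map_id[OF A]]) (simp_all add: chart_at_in[OF A] c x)

lemma to_chart_from_chart: "to_chart A c x (from_chart A c x u) = u"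
proof -
  have "chart_jacobian c c (id \<circ> id) x = chart_jacobian (chart_at A x) c id (id x) \<circ> chart_jacobian c (chart_at A x) id x"
    by (rule chart_jacobian_compose[OF A A A smooth_map_id[OF A] smooth_map_id[OF A]])
      (simp_all add: chart_at_in[OF A] c x)
  then show ?thesis
    by (simp add: to_chart_eq_chart_jacobian from_chart_eq_chart_jacobian chart_jacobian_id[OF A c x] fun_eq_iff)
qed

lemma from_chart_to_chart: "from_chart A c x (to_chart A c x u) = u"
proof -
  have "chart_jacobian (chart_at A x) (chart_at A x) (id \<circ> id) x
      = chart_jacobian c (chart_at A x) id (id x) \<circ> chart_jacobian (chart_at A x) c id x"
    by (rule chart_jacobian_compose[OF A A A smooth_map_id[OF A] smooth_map_id[OF A]])
      (simp_all add: chart_at_in[OF A] c x)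
  then show ?thesis
    by (simp add: to_chart_eq_chart_jacobian from_chart_eq_chart_jacobian chart_jacobian_id[OF A chart_at_in[OF A]] fun_eq_iff)
qed

end

lemma linear_differential:
  assumes "smooth_manifold A" "smooth_manifold B" "smooth_map A B f"
  shows "linear (differential A B f x)"
  unfolding differential_eq_chart_jacobian
  by (rule linear_chart_jacobian[OF assms]) (simp_all add: chart_at_in assms)

text \<open>The differential, defined through selected charts that may jump from point to point, acts on
  coordinate vectors of fixed charts through the ordinary Jacobian matrix, which varies smoothly.\<close>

lemma differential_from_chart:
  assumes A: "smooth_manifold A" and B: "smooth_manifold B" and f: "smooth_map A B f"
    and a: "a \<in> A" and b: "b \<in> B" and x: "x \<in> chart_dom a" "f x \<in> chart_dom b"
  shows "differential A B f x (from_chart A a x u) = from_chart B b (f x) (chart_jacobian a b f x u)"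
proof -
  let ?a = "chart_at A x" and ?b = "chart_at B (f x)"
  have "chart_jacobian a ?b (f \<circ> id) x = chart_jacobian ?a ?b f (id x) \<circ> chart_jacobian a ?a id x"
    by (rule chart_jacobian_compose[OF A A B smooth_map_id[OF A] f])
      (simp_all add: chart_at_in[OF A] chart_at_in[OF B] a x)
  moreover have "chart_jacobian a ?b (id \<circ> f) x = chart_jacobian b ?b id (f x) \<circ> chart_jacobian a b f x"
    by (rule chart_jacobian_compose[OF A B B f smooth_map_id[OF B]])
      (simp_all add: chart_at_in[OF A] chart_at_in[OF B] a b x)
  ultimately show ?thesis
    by (simp add: differential_eq_chart_jacobian from_chart_eq_chart_jacobian fun_eq_iff)
qed

text \<open>The map \<open>F\<close> will be the coordinate expression of the immersion: what has to be smooth are functions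
  on the submanifold, while the metric is smooth on the ambient manifold.\<close>

lemma smooth_on_metric_along:
  assumes B: "smooth_manifold B" and b: "b \<in> B" and g: "riemannian_metric B g"
    and U: "open U" and F: "smooth_on U F" "F ` U \<subseteq> chart_ran b"
    and v: "smooth_on U v" and w: "smooth_on U w"
  shows "smooth_on U (\<lambda>y. g (param b (F y)) (from_chart B b (param b (F y)) (v y))
    (from_chart B b (param b (F y)) (w y)))"
proof -
  have lin: "linear (from_chart B b (param b (F y)))" if "y \<in> U" for y
    using that F(2) by (intro linear_from_chart[OF B b] param_in_chart_dom[OF B b]) blast
  have bil: "bilinear (g q)" for q
    using g unfolding riemannian_metric_def by blast
  have "smooth_on U (\<lambda>y. g (param b (F y)) (from_chart B b (param b (F y)) u)
    (from_chart B b (param b (F y)) u'))" for u u'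
    using g b unfolding riemannian_metric_def
    by (intro smooth_on_compose[OF U open_chart_ran[OF B b] F(2,1)]) blast
  then have "smooth_on U (\<lambda>y. g (param b (F y)) (from_chart B b (param b (F y)) (v y))
      (from_chart B b (param b (F y)) u'))" for u'
    using bil by (intro smooth_on_apply_linear[OF U _ _ v, where
          L = "\<lambda>y u. g (param b (F y)) (from_chart B b (param b (F y)) u)
            (from_chart B b (param b (F y)) u')"]
        linear_compose[OF lin, unfolded comp_def]) (auto simp: bilinear_def)
  then show ?thesis
    using bil by (intro smooth_on_apply_linear[OF U _ _ w, where
          L = "\<lambda>y u'. g (param b (F y)) (from_chart B b (param b (F y)) (v y))
            (from_chart B b (param b (F y)) u')"]
        linear_compose[OF lin, unfolded comp_def]) (auto simp: bilinear_def)
qed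

lemma smooth_on_tensor_along:
  assumes B: "smooth_manifold B" and b: "b \<in> B" and J: "tensor11_field B J"
    and U: "open U" and F: "smooth_on U F" "F ` U \<subseteq> chart_ran b" and v: "smooth_on U v"
  shows "smooth_on U (\<lambda>y. to_chart B b (param b (F y))
    (J (param b (F y)) (from_chart B b (param b (F y)) (v y))))"
proof (rule smooth_on_apply_linear[OF U _ _ v])
  show "linear (\<lambda>u. to_chart B b (param b (F y)) (J (param b (F y)) (from_chart B b (param b (F y)) u)))"
    if "y \<in> U" for y
  proof -
    have q: "param b (F y) \<in> chart_dom b"
      using that F(2) by (intro param_in_chart_dom[OF B b]) blast
    have "linear (J (param b (F y)))"
      using J unfolding tensor11_field_def by blast
    from linear_compose[OF linear_compose[OF linear_from_chart[OF B b q] this] linear_to_chart[OF B b q]]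
    show ?thesis by (simp add: comp_def)
  qed
  show "smooth_on U (\<lambda>y. to_chart B b (param b (F y))
      (J (param b (F y)) (from_chart B b (param b (F y)) u)))" for u
    using J b unfolding tensor11_field_def
    by (intro smooth_on_compose[OF U open_chart_ran[OF B b] F(2,1)]) blast
qed

section \<open>Self-adjoint operators and orthogonal projection in a single tangent space\<close>

locale positive_form =
  fixes b :: "'f::euclidean_space \<Rightarrow> 'f \<Rightarrow> real"
  assumes bilinear: "bilinear b" and commute: "b u v = b v u" and pos: "u \<noteq> 0 \<Longrightarrow> b u u > 0"
begin

lemmas simps = bilinear_ladd[OF bilinear] bilinear_radd[OF bilinear]
  bilinear_lsub[OF bilinear] bilinear_rsub[OF bilinear]
  bilinear_lmul[OF bilinear] bilinear_rmul[OF bilinear]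
  bilinear_lzero[OF bilinear] bilinear_rzero[OF bilinear]

lemma nonneg: "b u u \<ge> 0"
  using pos[of u] by (cases "u = 0") (auto simp: simps)

lemma eq_0_iff: "b u u = 0 \<longleftrightarrow> u = 0"
  using pos[of u] by (cases "u = 0") (auto simp: simps)

lemma eqI: "(\<And>v. b u v = b u' v) \<Longrightarrow> u = u'"
  using eq_0_iff[of "u - u'"] by (simp add: simps)

lemma Cauchy_Schwarz: "\<bar>b u v\<bar> \<le> sqrt (b u u) * sqrt (b v v)"
proof (cases "v = 0")
  case False
  then have v: "b v v > 0" by (rule pos)
  let ?t = "b u v / b v v"
  have "0 \<le> b (u - ?t *\<^sub>R v) (u - ?t *\<^sub>R v)" by (rule nonneg)
  also have "\<dots> = b u u - (b u v)\<^sup>2 / b v v"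
    using v by (simp add: simps commute[of v u] field_simps power2_eq_square)
  finally have "(b u v)\<^sup>2 \<le> b u u * b v v"
    using v by (simp add: field_simps)
  then have "sqrt ((b u v)\<^sup>2) \<le> sqrt (b u u * b v v)" by (rule real_sqrt_le_mono)
  then show ?thesis by (simp add: real_sqrt_mult)
qed (simp add: simps)

lemma pullback:
  assumes "linear D" and "inj D"
  shows "positive_form (\<lambda>u v. b (D u) (D v))"
proof
  show "bilinear (\<lambda>u v. b (D u) (D v))"
    using assms(1) bilinear unfolding bilinear_def
    by (auto intro!: linear_compose[OF assms(1), unfolded comp_def])
  show "b (D u) (D u) > 0" if "u \<noteq> 0" for u
    using that assms linear_injective_0 pos by blast
qed (rule commute)

text \<open>Riesz representation: the linear map sending \<open>u\<close> to the tuple of values of \<open>b u\<close> on the basis is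
  injective by definiteness, hence surjective.\<close>

lemma representation:
  assumes "linear l"
  shows "\<exists>u. \<forall>v. b u v = l v"
proof -
  define L where "L u = (\<Sum>i\<in>Basis. b u i *\<^sub>R i)" for u
  have ext: "b u v = (\<Sum>i\<in>Basis. (v \<bullet> i) * b u i)" for u v
    using linear_expand_Basis[of "b u" v] bilinear by (simp add: bilinear_def)
  have "linear L"
    unfolding L_def by (rule linearI) (simp_all add: simps scaleR_add_left sum.distrib scaleR_sum_right)
  moreover have "inj L"
    unfolding linear_injective_0[OF \<open>linear L\<close>]
  proof (intro allI impI)
    fix u assume "L u = 0"
    then have "b u i = 0" if "i \<in> Basis" for i
      using inner_sum_left_Basis[OF that, of "b u"] unfolding L_def by simp
    then have "b u u = 0" by (subst ext) simp
    then show "u = 0" by (simp add: eq_0_iff)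
  qed
  ultimately have "surj L" by (rule linear_inj_imp_surj)
  then obtain u where u: "L u = (\<Sum>i\<in>Basis. l i *\<^sub>R i)" by (metis surjE)
  have "b u i = l i" if "i \<in> Basis" for i
    using arg_cong[OF u, of "\<lambda>z. z \<bullet> i"] inner_sum_left_Basis[OF that] unfolding L_def by simp
  then have "b u v = l v" for v
    unfolding ext[of u v] linear_expand_Basis[OF assms, of v] by simp
  then show ?thesis by blast
qed

text \<open>The cosine of the angle between \<open>w\<close> and a vector \<open>v\<close> of the subspace is
  \<open>b (D t) v / (\<bar>w\<bar> * \<bar>v\<bar>)\<close>, where \<open>D t\<close> is the orthogonal projection of \<open>w\<close>. By Cauchy-Schwarz it is
  at most \<open>\<bar>D t\<bar> / \<bar>w\<bar>\<close>, with equality at \<open>v = D t\<close> unless the projection vanishes; in that case all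
  the angles are right angles.\<close>

lemma cos_subspace_angle:
  assumes D: "linear D" "inj (D :: 'e::euclidean_space \<Rightarrow> 'f)" and w: "w \<noteq> 0"
    and t: "\<And>v. b w (D v) = b (D t) (D v)"
  shows "(cos (subspace_angle b w (range D)))\<^sup>2 * b w w = b (D t) (D t)"
proof -
  have ww: "b w w > 0" using w by (rule pos)
  have D0: "D u = 0 \<longleftrightarrow> u = 0" for u
    using D by (metis linear_0 linear_injective_0)
  have angle: "-1 \<le> b w v / (sqrt (b w w) * sqrt (b v v))" "b w v / (sqrt (b w w) * sqrt (b v v)) \<le> 1"
    if "v \<noteq> 0" for v
    using Cauchy_Schwarz[of w v] ww pos[OF that] by (auto simp: divide_simps abs_le_iff)
  show ?thesis
  proof (cases "t = 0")
    case True
    then have orth: "b w (D v) = 0" for v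
      using t[of v] linear_0[OF D(1)] by (simp add: simps)
    obtain i :: 'e where i: "i \<in> Basis"
      using nonempty_Basis by blast
    then have "D i \<in> range D - {0}" using D0 nonzero_Basis by auto
    moreover have "vector_angle b w v = pi / 2" if "v \<in> range D - {0}" for v
      using that orth by (auto simp: vector_angle_def)
    ultimately have "subspace_angle b w (range D) = pi / 2"
      unfolding subspace_angle_def by (intro cInf_eq_minimum) force+
    then have "cos (subspace_angle b w (range D)) = 0"
      by (simp only: cos_pi_half)
    then show ?thesis using True linear_0[OF D(1)] by (simp add: simps)
  next
    case False
    then have Dt: "D t \<noteq> 0" using D0 by simp
    have tt: "b (D t) (D t) > 0" using Dt by (rule pos)
    let ?r = "sqrt (b (D t) (D t)) / sqrt (b w w)"
    have r: "b w (D t) / (sqrt (b w w) * sqrt (b (D t) (D t))) = ?r"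
      using tt ww by (simp add: t divide_simps)
    have "vector_angle b w (D t) \<le> vector_angle b w v" if v: "v \<in> range D - {0}" for v
    proof -
      obtain u where u: "v = D u" using v by blast
      have "b w v \<le> sqrt (b (D t) (D t)) * sqrt (b v v)"
        using Cauchy_Schwarz[of "D t" v] t[of u] u by simp
      then have "b w v / (sqrt (b w w) * sqrt (b v v)) \<le> ?r"
        using ww pos[of v] v by (simp add: divide_simps mult.commute)
      then show ?thesis
        unfolding vector_angle_def r
        using angle[of v] angle[OF Dt] v r by (intro arccos_le_arccos) auto
    qed
    then have "subspace_angle b w (range D) = vector_angle b w (D t)"
      unfolding subspace_angle_def using Dt by (intro cInf_eq_minimum) auto
    then have "cos (subspace_angle b w (range D)) = ?r"
      using angle[OF Dt] unfolding vector_angle_def r by simp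
    then show ?thesis using ww tt by (simp add: power_divide)
  qed
qed

text \<open>Polarise the equality of \<open>b (D (P u)) (D (P u))\<close> with \<open>cos\<^sup>2 \<theta>\<close> times \<open>b (J (D u)) (J (D u))\<close>, and
  move \<open>P\<close> and \<open>J\<close> to the first argument by self-adjointness. Here \<open>P\<close> plays the role of the tangential
  part \<open>T\<close>, and \<open>D\<close> that of the differential of the immersion. Positivity of \<open>q\<close> makes \<open>J\<close> injective: the angle with \<open>J (D u)\<close> has its meaning
  only when that vector is nonzero.\<close>

lemma slant_projection_square:
  assumes D: "linear D" "inj (D :: 'e::euclidean_space \<Rightarrow> 'f)"
    and J: "linear J" "\<And>u v. b (J u) v = b u (J v)"
    and J2: "\<And>u. J (J u) = p *\<^sub>R J u + q *\<^sub>R u" and q: "q > 0"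
    and P: "\<And>u v. b (D (P u)) (D v) = b (J (D u)) (D v)"
    and slant: "\<And>u. u \<noteq> 0 \<Longrightarrow> subspace_angle b (J (D u)) (range D) = \<theta>"
  shows "P (P u) = (p * (cos \<theta>)\<^sup>2) *\<^sub>R P u + (q * (cos \<theta>)\<^sup>2) *\<^sub>R u"
proof -
  interpret h: positive_form "\<lambda>u v. b (D u) (D v)"
    using D by (rule pullback)
  define c where "c = (cos \<theta>)\<^sup>2"
  note lin = linear_add[OF D(1)] linear_cmul[OF D(1)] linear_0[OF D(1)] linear_diff[OF D(1)]
    linear_add[OF J(1)] linear_cmul[OF J(1)] linear_0[OF J(1)]
  have Padd: "P (u + v) = P u + P v" for u v
    by (rule h.eqI) (simp add: lin simps P)
  have P0: "P 0 = 0"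
    by (rule h.eqI) (simp add: lin simps P)
  have norm: "b (D (P u)) (D (P u)) = c * b (J (D u)) (J (D u))" for u
  proof (cases "u = 0")
    case False
    have "D u \<noteq> 0" using False D by (metis linear_injective_0)
    then have "J (D u) \<noteq> 0"
      using J2[of "D u"] q by (auto simp: lin)
    from cos_subspace_angle[OF D this P[symmetric]] show ?thesis
      by (simp add: slant[OF False] c_def)
  qed (simp add: P0 lin simps)
  have polar: "b (D (P u)) (D (P v)) = c * b (J (D u)) (J (D v))" for u v
  proof -
    have "b (D (P u)) (D (P u)) + 2 * b (D (P u)) (D (P v)) + b (D (P v)) (D (P v))
        = c * b (J (D u)) (J (D u)) + 2 * (c * b (J (D u)) (J (D v))) + c * b (J (D v)) (J (D v))"
      using norm[of "u + v"]
      by (simp add: Padd lin simps commute[of "D (P v)" "D (P u)"] commute[of "J (D v)" "J (D u)"]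
          algebra_simps)
    then show ?thesis using norm[of u] norm[of v] by simp
  qed
  show ?thesis
  proof (rule h.eqI)
    fix v
    have "b (D (P (P u))) (D v) = b (D (P u)) (J (D v))"
      by (simp add: P J(2))
    also have "\<dots> = b (D (P u)) (D (P v))"
      using P[of v "P u"] by (simp add: commute)
    also have "\<dots> = c * b (J (J (D u))) (D v)"
      by (simp add: polar J(2))
    also have "\<dots> = b (D ((p * c) *\<^sub>R P u + (q * c) *\<^sub>R u)) (D v)"
      by (simp add: J2 lin simps P algebra_simps)
    finally show "b (D (P (P u))) (D v)
        = b (D ((p * (cos \<theta>)\<^sup>2) *\<^sub>R P u + (q * (cos \<theta>)\<^sup>2) *\<^sub>R u)) (D v)"
      by (simp add: c_def)
  qed
qed

end

section \<open>The tangential part of the structure\<close>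

lemma positive_form_riemannian_metric:
  "riemannian_metric B g \<Longrightarrow> positive_form (g q)"
  unfolding riemannian_metric_def positive_form_def by blast

text \<open>The description operator in \<open>tangential\<close> denotes a vector because the metric restricted to the
  image of the differential is definite: existence is Riesz representation for the induced form.\<close>

lemma tangential_eq:
  assumes "smooth_manifold A" "smooth_manifold B" "immersion A B f" "riemannian_metric B g"
  shows "g (f x) (differential A B f x (tangential A B f g x w)) (differential A B f x v)
    = g (f x) w (differential A B f x v)"
proof -
  let ?D = "differential A B f x"
  have lin: "linear ?D" and inj: "inj ?D"
    using assms by (auto simp: immersion_def linear_differential)
  interpret g: positive_form "g (f x)"
    using assms(4) by (rule positive_form_riemannian_metric)
  interpret h: positive_form "\<lambda>u v. g (f x) (?D u) (?D v)"
    using lin inj by (rule g.pullback)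
  have "linear (\<lambda>v. g (f x) w (?D v))"
    using g.bilinear lin unfolding bilinear_def by (auto intro: linear_compose[unfolded comp_def])
  then obtain u where u: "\<forall>v. g (f x) (?D u) (?D v) = g (f x) w (?D v)"
    using h.representation by blast
  have "\<exists>!u. \<forall>v. g (f x) (w - ?D u) (?D v) = 0"
  proof (rule ex1I)
    show "\<forall>v. g (f x) (w - ?D u) (?D v) = 0"
      using u by (simp add: g.simps)
    show "u' = u" if "\<forall>v. g (f x) (w - ?D u') (?D v) = 0" for u'
      using that u by (intro h.eqI) (simp add: g.simps)
  qed
  then have "\<forall>v. g (f x) (w - ?D (tangential A B f g x w)) (?D v) = 0"
    unfolding tangential_def by (rule theI')
  then show ?thesis by (simp add: g.simps)
qed

text \<open>Near a given point, fix a chart \<open>a\<close> of the submanifold and a chart \<open>b\<close> of the ambient manifold, and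
  let \<open>F\<close> be the immersion in these coordinates. Pairing \<open>TY\<close> with the coordinate fields yields a
  system for its components in \<open>a\<close>: the matrix \<open>M\<close> is the Gram matrix of the coordinate fields, and the
  right-hand side \<open>R\<close> pairs them with \<open>JY\<close>. Both are computed in \<open>b\<close>, where everything is a smooth
  expression in \<open>F\<close>, its derivatives and the components of \<open>Y\<close>.\<close>

lemma smooth_vector_field_tangential_part:
  assumes A: "smooth_manifold A" and B: "smooth_manifold B" and f: "immersion A B f"
    and g: "riemannian_metric B g" and J: "tensor11_field B J" and Y: "smooth_vector_field A Y"
  shows "smooth_vector_field A (\<lambda>x. tangential_part A B f g J x (Y x))"
  unfolding smooth_vector_field_def
proof (intro ballI smooth_on_local)
  fix a y assume a: "a \<in> A" and y: "y \<in> chart_ran a"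
  define b where "b = chart_at B (f (param a y))"
  define F where "F = coord b \<circ> f \<circ> param a"
  define U where "U = coord a ` (chart_dom a \<inter> f -` chart_dom b)"
  have fm: "smooth_map A B f" using f by (simp add: immersion_def)
  have b: "b \<in> B" unfolding b_def using B by (rule chart_at_in)
  have U: "open U" unfolding U_def using A B fm a b by (rule open_local_rep_domain)
  have yU: "y \<in> U"
    using coord_param[OF A a y] param_in_chart_dom[OF A a y] chart_at_in(2)[OF B]
    unfolding U_def b_def by (metis IntI image_eqI vimageI)
  have F: "smooth_on U F"
    using fm a b unfolding smooth_map_def F_def U_def by blast
  have inU: "param a z \<in> chart_dom a" "f (param a z) \<in> chart_dom b" "coord a (param a z) = z"
    "z \<in> chart_ran a" "F z \<in> chart_ran b" "param b (F z) = f (param a z)" if "z \<in> U" for z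
    using that unfolding U_def F_def
    by (auto simp: param_coord[OF A a] param_coord[OF B b] chart_ran_def)
  have Fran: "F ` U \<subseteq> chart_ran b" using inU by blast
  have chart_jacobian: "chart_jacobian a b f (param a z) = frechet_derivative F (at z)" if "z \<in> U" for z
    using inU[OF that] by (simp add: chart_jacobian_def F_def)

  let ?D = "\<lambda>z. differential A B f (param a z)" and ?E = "\<lambda>z. from_chart A a (param a z)"
  let ?T = "\<lambda>x. tangential_part A B f g J x (Y x)"
  let ?W = "\<lambda>z. to_chart A a (param a z) (?T (param a z))"
  have DE: "?D z (?E z u) = from_chart B b (param b (F z)) (frechet_derivative F (at z) u)"
    if "z \<in> U" for z u
    using differential_from_chart[OF A B fm a b, of "param a z" u] inU[OF that] chart_jacobian[OF that] by simp

  \<comment> \<open>The components of \<open>Y\<close> in \<open>a\<close>, and those of \<open>JY\<close> in \<open>b\<close>.\<close>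
  define y' where "y' z = to_chart A a (param a z) (Y (param a z))" for z
  define JY where "JY z = to_chart B b (param b (F z)) (J (param b (F z))
      (from_chart B b (param b (F z)) (frechet_derivative F (at z) (y' z))))" for z
  have y': "smooth_on U y'"
  proof (rule smooth_on_subset)
    show "smooth_on (chart_ran a) y'"
      using Y a unfolding smooth_vector_field_def y'_def by blast
  qed (use inU(4) in blast)
  have "smooth_on U (\<lambda>z. frechet_derivative F (at z) (y' z))"
    by (rule smooth_on_apply_linear[OF U _ smooth_on_frechet_derivative[OF F] y'])
      (rule has_derivative_linear[OF smooth_on_has_derivative[OF F]])
  then have JY: "smooth_on U JY"
    unfolding JY_def by (rule smooth_on_tensor_along[OF B b J U F Fran])
  have JDY: "J (f (param a z)) (?D z (Y (param a z))) = from_chart B b (param b (F z)) (JY z)"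
    if z: "z \<in> U" for z
  proof -
    have "?D z (Y (param a z))
        = from_chart B b (param b (F z)) (frechet_derivative F (at z) (y' z))"
      using DE[OF z, of "y' z"] from_chart_to_chart[OF A a inU(1)[OF z]] by (simp add: y'_def)
    then show ?thesis
      unfolding JY_def using inU[OF z] by (simp add: from_chart_to_chart[OF B b])
  qed

  define M where "M i j z = g (f (param a z)) (?D z (?E z j)) (?D z (?E z i))" for i j z
  define R where "R i z = g (f (param a z)) (J (f (param a z)) (?D z (Y (param a z)))) (?D z (?E z i))"
    for i z
  have W: "smooth_on U (\<lambda>z. ?W z \<bullet> l)" if "l \<in> Basis" for l
  proof (rule smooth_on_positive_definite_solution[OF U finite_Basis, of M R "\<lambda>l z. ?W z \<bullet> l" l])
    show "smooth_on U (M i j)" for i j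
      by (rule smooth_on_cong[OF U _ smooth_on_metric_along[OF B b g U F Fran
              smooth_on_frechet_derivative[OF F, of j] smooth_on_frechet_derivative[OF F, of i]]])
        (simp add: M_def DE inU)
    show "smooth_on U (R i)" for i
      by (rule smooth_on_cong[OF U _ smooth_on_metric_along[OF B b g U F Fran
              JY smooth_on_frechet_derivative[OF F, of i]]])
        (simp add: R_def DE JDY inU)
  next
    fix z assume z: "z \<in> U"
    interpret g: positive_form "g (f (param a z))"
      using g by (rule positive_form_riemannian_metric)
    have "linear (?E z)" using A a inU(1)[OF z] by (rule linear_from_chart)
    moreover have "inj (?E z)"
      using to_chart_from_chart[OF A a inU(1)[OF z]] by (rule inj_on_inverseI)
    moreover have "linear (?D z)" "inj (?D z)"
      using f A B by (auto simp: immersion_def linear_differential)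
    ultimately have "linear (\<lambda>u. ?D z (?E z u))" "inj (\<lambda>u. ?D z (?E z u))"
      using linear_compose inj_compose by (force simp: comp_def)+
    then interpret h: positive_form "\<lambda>u v. g (f (param a z)) (?D z (?E z u)) (?D z (?E z v))"
      by (rule g.pullback)
    let ?h = "\<lambda>u v. g (f (param a z)) (?D z (?E z u)) (?D z (?E z v))"
    have hr: "linear (?h u)" and hl: "linear (\<lambda>u. ?h u v)" for u v
      using h.bilinear by (auto simp: bilinear_def)
    have row: "(\<Sum>j\<in>Basis. M i j z * c j) = ?h (\<Sum>j\<in>Basis. c j *\<^sub>R j) i" for i c
      using linear_expand_Basis[OF hl, of "\<Sum>j\<in>Basis. c j *\<^sub>R j" i]
      by (simp add: M_def mult.commute)
    show "(\<Sum>i\<in>Basis. c i * (\<Sum>j\<in>Basis. M i j z * c j)) > 0" if c: "\<exists>i\<in>Basis. c i \<noteq> 0" for c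
    proof -
      let ?c = "\<Sum>j\<in>Basis. c j *\<^sub>R j"
      have "?c \<noteq> 0"
        using c by (metis inner_sum_left_Basis inner_zero_left)
      then have "?h ?c ?c > 0" by (rule h.pos)
      also have "?h ?c ?c = (\<Sum>i\<in>Basis. c i * (\<Sum>j\<in>Basis. M i j z * c j))"
        unfolding row using linear_expand_Basis[OF hr, of ?c ?c] by simp
      finally show ?thesis .
    qed
    show "(\<Sum>j\<in>Basis. M i j z * (?W z \<bullet> j)) = R i z" for i
    proof -
      have "(\<Sum>j\<in>Basis. M i j z * (?W z \<bullet> j)) = ?h (?W z) i"
        unfolding row by (simp add: euclidean_representation)
      also have "\<dots> = R i z"
        unfolding R_def from_chart_to_chart[OF A a inU(1)[OF z]] tangential_part_def
        by (rule tangential_eq[OF A B f g])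
      finally show ?thesis .
    qed
  qed (rule that)
  have "smooth_on U (\<lambda>z. \<Sum>l\<in>Basis. (?W z \<bullet> l) *\<^sub>R l)"
    by (intro smooth_on_sum smooth_on_scaleR smooth_on_const W U)
  then have "smooth_on U ?W" by (simp add: euclidean_representation)
  then show "\<exists>U. open U \<and> y \<in> U \<and> smooth_on U ?W"
    using U yU by blast
qed

lemma smooth_fun_const: "smooth_fun A (\<lambda>x. c)"
  by (simp add: smooth_fun_def comp_def smooth_on_const)

lemma smooth_vector_field_scale:
  assumes A: "smooth_manifold A" and Y: "smooth_vector_field A Y"
  shows "smooth_vector_field A (\<lambda>x. (c::real) *\<^sub>R Y x)"
  unfolding smooth_vector_field_def
proof
  fix a assume a: "a \<in> A"
  show "smooth_on (chart_ran a) (\<lambda>y. to_chart A a (param a y) (c *\<^sub>R Y (param a y)))"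
  proof (rule smooth_on_cong[OF open_chart_ran[OF A a]])
    show "smooth_on (chart_ran a) (\<lambda>y. c *\<^sub>R to_chart A a (param a y) (Y (param a y)))"
      using Y a unfolding smooth_vector_field_def
      by (intro smooth_on_scaleR open_chart_ran[OF A a] smooth_on_const) blast
    show "c *\<^sub>R to_chart A a (param a y) (Y (param a y))
        = to_chart A a (param a y) (c *\<^sub>R Y (param a y))" if "y \<in> chart_ran a" for y
      using linear_to_chart[OF A a param_in_chart_dom[OF A a that]] by (simp add: linear_cmul)
  qed
qed

text \<open>Constants come out of a connection because the derivative term in the Leibniz rule vanishes.\<close>

lemma affine_connection_linear_combination:
  assumes A: "smooth_manifold A" and nabla: "affine_connection A nabla"
    and "smooth_vector_field A X" "smooth_vector_field A Y" "smooth_vector_field A Z"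
  shows "nabla X (\<lambda>x. c *\<^sub>R Y x + d *\<^sub>R Z x) = (\<lambda>x. c *\<^sub>R nabla X Y x + d *\<^sub>R nabla X Z x)"
proof -
  have "deriv_along A X (\<lambda>_. k) x = 0" for k x
    by (simp add: deriv_along_def comp_def)
  then have "nabla X (\<lambda>x. k *\<^sub>R V x) = (\<lambda>x. k *\<^sub>R nabla X V x)"
    if "smooth_vector_field A V" for k V
    using nabla assms(3) that smooth_fun_const[of A k] unfolding affine_connection_def by simp
  then show ?thesis
    using nabla assms(3-) smooth_vector_field_scale[OF A]
    unfolding affine_connection_def by simp
qed

theorem proposition3p23:
  fixes A :: "('m::{t2_space, second_countable_topology}, 'e::euclidean_space) chart set"
    and B :: "('n::{t2_space, second_countable_topology}, 'f::euclidean_space) chart set"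
    and g :: "'n \<Rightarrow> 'f \<Rightarrow> 'f \<Rightarrow> real"
    and J :: "'n \<Rightarrow> 'f \<Rightarrow> 'f"
    and f :: "'m \<Rightarrow> 'n"
    and nabla :: "('m \<Rightarrow> 'e) \<Rightarrow> ('m \<Rightarrow> 'e) \<Rightarrow> 'm \<Rightarrow> 'e"
    and X Y :: "'m \<Rightarrow> 'e"
    and T :: "'m \<Rightarrow> 'e \<Rightarrow> 'e"
    and p q :: nat and \<theta> :: real
  defines "T \<equiv> tangential_part A B f g J"
  assumes "metallic_riemannian_manifold B J g p q"
    and "smooth_manifold A"
    and "immersion A B f"
    and "levi_civita A (induced_metric A B f g) nabla"
    and "slant A B f g J \<theta>"
    and "smooth_vector_field A X"
    and "smooth_vector_field A Y"
  shows "cov_deriv_tensor11 nabla (\<lambda>x. T x \<circ> T x) X Y =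
    (\<lambda>x. (real p * (cos \<theta>)\<^sup>2) *\<^sub>R cov_deriv_tensor11 nabla T X Y x)"
proof -
  have B: "smooth_manifold B" and g: "riemannian_metric B g" and J: "tensor11_field B J"
    and q: "q > 0" and J2: "\<And>x u. J x (J x u) = real p *\<^sub>R J x u + real q *\<^sub>R u"
    and adj: "\<And>x u v. g x (J x u) v = g x u (J x v)"
    using assms(2) unfolding metallic_riemannian_manifold_def by auto
  have nabla: "affine_connection A nabla"
    using assms(5) by (simp add: levi_civita_def)
  have TT: "T x (T x u) = (real p * (cos \<theta>)\<^sup>2) *\<^sub>R T x u + (real q * (cos \<theta>)\<^sup>2) *\<^sub>R u" for x u
  proof (rule positive_form.slant_projection_square[OF positive_form_riemannian_metric[OF g]])
    show "linear (differential A B f x)" "inj (differential A B f x)"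
      using assms(4) by (auto simp: immersion_def linear_differential assms(3) B)
    show "linear (J (f x))"
      using J unfolding tensor11_field_def by blast
    show "g (f x) (differential A B f x (T x u)) (differential A B f x v)
        = g (f x) (J (f x) (differential A B f x u)) (differential A B f x v)" for u v
      unfolding T_def tangential_part_def by (rule tangential_eq[OF assms(3) B assms(4) g])
    show "subspace_angle (g (f x)) (J (f x) (differential A B f x u)) (range (differential A B f x)) = \<theta>"
      if "u \<noteq> 0" for u
      using assms(6) that unfolding slant_def by blast
  qed (use q J2 adj in auto)
  have "smooth_vector_field A (\<lambda>x. T x (Y x))"
    unfolding T_def using assms(3) B assms(4) g J assms(8) by (rule smooth_vector_field_tangential_part)
  then have "nabla X (\<lambda>x. (real p * (cos \<theta>)\<^sup>2) *\<^sub>R T x (Y x) + (real q * (cos \<theta>)\<^sup>2) *\<^sub>R Y x)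
      = (\<lambda>x. (real p * (cos \<theta>)\<^sup>2) *\<^sub>R nabla X (\<lambda>x. T x (Y x)) x
          + (real q * (cos \<theta>)\<^sup>2) *\<^sub>R nabla X Y x)"
    by (rule affine_connection_linear_combination[OF assms(3) nabla assms(7) _ assms(8)])
  then show ?thesis
    by (simp add: cov_deriv_tensor11_def TT scaleR_diff_right)
qed

end
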